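(* Let $C_{w,f}$ be a weighted composition operator on $L^p(\mu)$. For each $n \in \mathbb{N}$, \[ \|(C_{w,f})^n\| = \sup_{0 < \mu(B) < \infty} \Big(\frac{\mu_n(f^{-n}(B))}{\mu(B)}\Big)^{\frac{1}{p}}, \] where the supremum is taken over all measurable sets $B$ satisfying $0 < \mu(B) < \infty$. In particular, $C_{w,f}$ is power-bounded if and only if there exists a constant $C \in (0,\infty)$ such that, for each measurable set $B$ of finite positive $\mu$-measure, \[ \mu_n(f^{-n}(B)) \le C\, \mu(B) \quad \text{for all } n \in \mathbb{N}. \]
   Context: Fix $\mathbb{K} = \mathbb{R}$ or $\mathbb{C}$, a real number $p \in [1,\infty)$ and an arbitrary positive measure space $(X,\mathfrak{M},\mu)$. $L^p(\mu)$ is the Banach space over $\mathbb{K}$ of all $\mathbb{K}$-valued $p$-integrable functions with norm $\|\varphi\|_p = (\int_X |\varphi|^p d\mu)^{1/p}$. A weighted composition operator on $L^p(\mu)$ is the map $C_{w,f}(\varphi) = (\varphi \circ f)\cdot w$, where $w : X \to \mathbb{K}$ is measurable with $\varphi\cdot w \in L^p(\mu)$ for all $\varphi \in L^p(\mu)$, $f : X \to X$ is bimeasurable (i.e. $f(B) \in \mathfrak{M}$ and $f^{-1}(B) \in \mathfrak{M}$ whenever $B \in \mathfrak{M}$), and there is a constant $c \in (0,\infty)$ such that $\int_B |w|^p d\mu \le c\,\mu(f(B))$ for every $B \in \mathfrak{M}$; these conditions make $C_{w,f}$ a well-defined bounded linear operator on $L^p(\mu)$. Put $w^{(1)} = w$,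 $w^{(n)} = (w\circ f^{n-1})\cdots(w\circ f)\cdot w$ for $n \ge 2$, and $\mu_n(B) = \int_B |w^{(n)}|^p d\mu$ for $B \in \mathfrak{M}$, $n \in \mathbb{N} = \{1,2,\ldots\}$. An operator $T$ on a Banach space is power-bounded if there is $C \in (0,\infty)$ with $\|T^n\| \le C$ for all $n \in \mathbb{N}$. The supremum of an empty set of nonnegative numbers is taken to be $0$. *)

theory Defs
  imports "HOL-Analysis.Analysis"
begin

text \<open>
  The scalar field is a type \<open>'k\<close> of sort
  \<open>{real_normed_field, banach, second_countable_topology}\<close>. Both \<open>real\<close> and \<open>complex\<close> have
  this sort, and by Gelfand--Mazur they are, up to isometric isomorphism, its only members.
\<close>

definition Lp_fun ::
  "'a measure \<Rightarrow> real \<Rightarrow> ('a \<Rightarrow> 'k::{real_normed_field, banach, second_countable_topology}) set"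
  where "Lp_fun M p = {\<phi> \<in> borel_measurable M. integrable M (\<lambda>x. norm (\<phi> x) powr p)}"

definition Lp_rel ::
  "'a measure \<Rightarrow> real \<Rightarrow>
    (('a \<Rightarrow> 'k) \<times> ('a \<Rightarrow> 'k::{real_normed_field, banach, second_countable_topology})) set"
  where "Lp_rel M p =
    {(\<phi>, \<psi>). \<phi> \<in> Lp_fun M p \<and> \<psi> \<in> Lp_fun M p \<and> (AE x in M. \<phi> x = \<psi> x)}"

definition Lp ::
  "'a measure \<Rightarrow> real \<Rightarrow> ('a \<Rightarrow> 'k::{real_normed_field, banach, second_countable_topology}) set set"
  where "Lp M p = Lp_fun M p // Lp_rel M p"

definition Lp_fun_norm ::
  "'a measure \<Rightarrow> real \<Rightarrow> ('a \<Rightarrow> 'k::{real_normed_field, banach, second_countable_topology}) \<Rightarrow> real"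
  where "Lp_fun_norm M p \<phi> = (\<integral>x. norm (\<phi> x) powr p \<partial>M) powr (1 / p)"

text \<open>
  \<^const>\<open>Lp_fun_norm\<close> is constant on each class, so the image below is a singleton for
  every \<open>F \<in> Lp M p\<close>.
\<close>

definition Lp_norm ::
  "'a measure \<Rightarrow> real \<Rightarrow> ('a \<Rightarrow> 'k::{real_normed_field, banach, second_countable_topology}) set \<Rightarrow> real"
  where "Lp_norm M p F = the_elem (Lp_fun_norm M p ` F)"

text \<open>
  The operator norm takes values in \<^typ>\<open>ennreal\<close>, so that it is \<open>\<infinity>\<close>, rather than an
  unspecified real number, for an unbounded map.
\<close>

definition Lp_opnorm ::
  "'a measure \<Rightarrow> real \<Rightarrow>
    (('a \<Rightarrow> 'k) set \<Rightarrow> ('a \<Rightarrow> 'k::{real_normed_field, banach, second_countable_topology}) set) \<Rightarrow> ennreal"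
  where "Lp_opnorm M p T = (SUP F \<in> {F \<in> Lp M p. Lp_norm M p F \<le> 1}. ennreal (Lp_norm M p (T F)))"

definition power_bounded ::
  "'a measure \<Rightarrow> real \<Rightarrow>
    (('a \<Rightarrow> 'k) set \<Rightarrow> ('a \<Rightarrow> 'k::{real_normed_field, banach, second_countable_topology}) set) \<Rightarrow> bool"
  where "power_bounded M p T \<longleftrightarrow> (\<exists>C::real. 0 < C \<and> (\<forall>n\<ge>1. Lp_opnorm M p (T ^^ n) \<le> ennreal C))"

definition bimeasurable :: "'a measure \<Rightarrow> ('a \<Rightarrow> 'a) \<Rightarrow> bool"
  where "bimeasurable M f \<longleftrightarrow> f \<in> M \<rightarrow>\<^sub>M M \<and> (\<forall>B\<in>sets M. f ` B \<in> sets M)"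

locale weighted_composition =
  fixes M :: "'a measure" and p :: real
    and w :: "'a \<Rightarrow> 'k::{real_normed_field, banach, second_countable_topology}"
    and f :: "'a \<Rightarrow> 'a"
  assumes w_measurable: "w \<in> borel_measurable M"
    and w_multiplier: "\<And>\<phi>. \<phi> \<in> Lp_fun M p \<Longrightarrow> (\<lambda>x. \<phi> x * w x) \<in> Lp_fun M p"
    and f_bimeasurable: "bimeasurable M f"
    and weight_bound: "\<exists>c::real. 0 < c \<and>
      (\<forall>B\<in>sets M. (\<integral>\<^sup>+x\<in>B. ennreal (norm (w x) powr p) \<partial>M) \<le> ennreal c * emeasure M (f ` B))"

text \<open>
  The induced map on classes, lifted from representatives as usual for quotients (see
  \<open>wc_op_class\<close> below for independence of the representative).
\<close>

definition wc_op ::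
  "'a measure \<Rightarrow> real \<Rightarrow> ('a \<Rightarrow> 'k::{real_normed_field, banach, second_countable_topology}) \<Rightarrow>
    ('a \<Rightarrow> 'a) \<Rightarrow> ('a \<Rightarrow> 'k) set \<Rightarrow> ('a \<Rightarrow> 'k) set"
  where "wc_op M p w f F = (\<Union>\<phi>\<in>F. Lp_rel M p `` {\<lambda>x. \<phi> (f x) * w x})"

definition iter_weight :: "('a \<Rightarrow> 'k::real_normed_field) \<Rightarrow> ('a \<Rightarrow> 'a) \<Rightarrow> nat \<Rightarrow> 'a \<Rightarrow> 'k"
  where "iter_weight w f n x = (\<Prod>i<n. w ((f ^^ i) x))"

definition iter_measure ::
  "'a measure \<Rightarrow> real \<Rightarrow> ('a \<Rightarrow> 'k::real_normed_field) \<Rightarrow> ('a \<Rightarrow> 'a) \<Rightarrow> nat \<Rightarrow> 'a measure"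
  where "iter_measure M p w f n = density M (\<lambda>x. ennreal (norm (iter_weight w f n x) powr p))"

text \<open>Intended for exponents \<open>a > 0\<close> only.\<close>

definition ennreal_powr :: "ennreal \<Rightarrow> real \<Rightarrow> ennreal"
  where "ennreal_powr x a = (if x = \<infinity> then \<infinity> else ennreal (enn2real x powr a))"


lemma equiv_Lp_rel: "equiv (Lp_fun M p) (Lp_rel M p)"
  by (rule equivI) (auto simp: Lp_rel_def refl_on_def sym_def trans_def elim: AE_mp)

lemma Lp_fun_norm_cong:
  assumes "(\<phi>, \<psi>) \<in> Lp_rel M p"
  shows "Lp_fun_norm M p \<phi> = Lp_fun_norm M p \<psi>"
proof -
  have "(\<integral>x. norm (\<phi> x) powr p \<partial>M) = (\<integral>x. norm (\<psi> x) powr p \<partial>M)"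
    using assms by (intro integral_cong_AE) (auto simp: Lp_rel_def Lp_fun_def)
  then show ?thesis by (simp add: Lp_fun_norm_def)
qed

lemma Lp_norm_class:
  assumes "\<phi> \<in> Lp_fun M p"
  shows "Lp_norm M p (Lp_rel M p `` {\<phi>}) = Lp_fun_norm M p \<phi>"
proof -
  have "\<phi> \<in> Lp_rel M p `` {\<phi>}"
    using equiv_class_self[OF equiv_Lp_rel assms] .
  moreover have "Lp_fun_norm M p \<psi> = Lp_fun_norm M p \<phi>" if "\<psi> \<in> Lp_rel M p `` {\<phi>}" for \<psi>
    using that by (simp add: Lp_fun_norm_cong)
  ultimately have "Lp_fun_norm M p ` (Lp_rel M p `` {\<phi>}) = {Lp_fun_norm M p \<phi>}"
    by (metis empty_iff image_constant_conv image_cong)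
  then show ?thesis by (simp add: Lp_norm_def)
qed

context weighted_composition
begin

lemma weighted_vimage_bound:
  obtains c :: real where "0 < c"
    "\<And>B. B \<in> sets M \<Longrightarrow>
      emeasure (distr (density M (\<lambda>x. ennreal (norm (w x) powr p))) M f) B \<le> ennreal c * emeasure M B"
proof -
  have [measurable]: "w \<in> borel_measurable M" "f \<in> M \<rightarrow>\<^sub>M M"
    using w_measurable f_bimeasurable by (auto simp: bimeasurable_def)
  obtain c :: real where c: "0 < c"
    "\<And>B. B \<in> sets M \<Longrightarrow>
      (\<integral>\<^sup>+x\<in>B. ennreal (norm (w x) powr p) \<partial>M) \<le> ennreal c * emeasure M (f ` B)"
    using weight_bound by blast
  show thesis
  proof (rule that[OF c(1)])
    fix B assume B[measurable]: "B \<in> sets M"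
    let ?A = "f -` B \<inter> space M"
    have A: "?A \<in> sets M" by measurable
    have "emeasure (distr (density M (\<lambda>x. ennreal (norm (w x) powr p))) M f) B =
        (\<integral>\<^sup>+x\<in>?A. ennreal (norm (w x) powr p) \<partial>M)"
      using A by (simp add: emeasure_distr emeasure_density)
    also have "\<dots> \<le> ennreal c * emeasure M (f ` ?A)"
      by (rule c(2)[OF A])
    also have "\<dots> \<le> ennreal c * emeasure M B"
      by (intro mult_left_mono emeasure_mono B) auto
    finally show "emeasure (distr (density M (\<lambda>x. ennreal (norm (w x) powr p))) M f) B
        \<le> ennreal c * emeasure M B" .
  qed
qed

lemma wc_fun_in_Lp_fun:
  assumes "\<phi> \<in> Lp_fun M p"
  shows "(\<lambda>x. \<phi> (f x) * w x) \<in> Lp_fun M p"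
proof -
  have [measurable]: "w \<in> borel_measurable M" "f \<in> M \<rightarrow>\<^sub>M M" "\<phi> \<in> borel_measurable M"
    using w_measurable f_bimeasurable assms by (auto simp: bimeasurable_def Lp_fun_def)
  define N where "N = distr (density M (\<lambda>x. ennreal (norm (w x) powr p))) M f"
  obtain c :: real where c: "0 < c" "\<And>B. B \<in> sets M \<Longrightarrow> emeasure N B \<le> ennreal c * emeasure M B"
    using weighted_vimage_bound unfolding N_def by blast
  have N_sets: "sets N = sets (density M (\<lambda>_. ennreal c))"
    by (simp add: N_def)
  have "N \<le> density M (\<lambda>_. ennreal c)"
    using c(2) N_sets by (subst le_measure) (auto simp: emeasure_density_const N_def)
  then have "(\<integral>\<^sup>+x. ennreal (norm (\<phi> x) powr p) \<partial>N) \<le>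
      (\<integral>\<^sup>+x. ennreal (norm (\<phi> x) powr p) \<partial>density M (\<lambda>_. ennreal c))"
    using N_sets by (intro nn_integral_mono_measure) auto
  also have "\<dots> = ennreal c * (\<integral>\<^sup>+x. ennreal (norm (\<phi> x) powr p) \<partial>M)"
    by (simp add: nn_integral_density nn_integral_cmult)
  also have "\<dots> < \<infinity>"
    using assms by (auto simp: Lp_fun_def integrable_iff_bounded ennreal_mult_less_top)
  also have "(\<integral>\<^sup>+x. ennreal (norm (\<phi> x) powr p) \<partial>N) =
      (\<integral>\<^sup>+x. ennreal (norm (\<phi> (f x) * w x) powr p) \<partial>M)"
    by (simp add: N_def nn_integral_distr nn_integral_density norm_mult powr_mult ennreal_mult' mult.commute)
  finally show ?thesis
    by (simp add: Lp_fun_def integrable_iff_bounded)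
qed

lemma wc_fun_cong:
  assumes "(\<phi>, \<psi>) \<in> Lp_rel M p"
  shows "((\<lambda>x. \<phi> (f x) * w x), (\<lambda>x. \<psi> (f x) * w x)) \<in> Lp_rel M p"
proof -
  have [measurable]: "w \<in> borel_measurable M" "f \<in> M \<rightarrow>\<^sub>M M"
      "\<phi> \<in> borel_measurable M" "\<psi> \<in> borel_measurable M"
    using w_measurable f_bimeasurable assms
    by (auto simp: bimeasurable_def Lp_fun_def Lp_rel_def)
  define N where "N = distr (density M (\<lambda>x. ennreal (norm (w x) powr p))) M f"
  obtain c :: real where c: "0 < c" "\<And>B. B \<in> sets M \<Longrightarrow> emeasure N B \<le> ennreal c * emeasure M B"
    using weighted_vimage_bound unfolding N_def by blast
  let ?B = "{x \<in> space M. \<phi> x \<noteq> \<psi> x}"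
  have B: "?B \<in> sets M" by measurable
  have "AE x in M. \<phi> x = \<psi> x" using assms by (simp add: Lp_rel_def)
  then have "emeasure M ?B = 0"
    using B by (subst (asm) AE_iff_measurable[OF B]) auto
  then have "emeasure N ?B = 0" using c(2)[OF B] by simp
  then have "AE x in N. \<phi> x = \<psi> x"
    using B by (subst AE_iff_measurable[of ?B]) (auto simp: N_def)
  then have "AE x in density M (\<lambda>x. ennreal (norm (w x) powr p)). \<phi> (f x) = \<psi> (f x)"
    unfolding N_def by (rule AE_distrD[rotated]) simp
  then have "AE x in M. 0 < ennreal (norm (w x) powr p) \<longrightarrow> \<phi> (f x) = \<psi> (f x)"
    by (subst (asm) AE_density) auto
  then have "AE x in M. \<phi> (f x) * w x = \<psi> (f x) * w x"
    by (rule AE_mp) (auto intro!: AE_I2)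
  then show ?thesis
    using assms by (simp add: Lp_rel_def wc_fun_in_Lp_fun)
qed

lemma wc_op_class:
  assumes "\<phi> \<in> Lp_fun M p"
  shows "wc_op M p w f (Lp_rel M p `` {\<phi>}) = Lp_rel M p `` {\<lambda>x. \<phi> (f x) * w x}"
  unfolding wc_op_def
proof (rule UN_equiv_class[OF equiv_Lp_rel _ assms])
  show "(\<lambda>\<phi>. Lp_rel M p `` {\<lambda>x. \<phi> (f x) * w x}) respects Lp_rel M p"
    by (auto simp: congruent_def intro!: equiv_class_eq[OF equiv_Lp_rel] wc_fun_cong)
qed

end

end

theory Submission
  imports Defs
begin

text \<open>
  Write \<open>\<nu>\<^sub>n(B) = \<mu>\<^sub>n(f\<^sup>-\<^sup>n(B))\<close>. By change of variables,
  \<open>\<parallel>(C\<^bsub>w,f\<^esub>)\<^sup>n \<phi>\<parallel>\<^sup>p\<close> is the integral of \<open>|\<phi>|\<^sup>p\<close> with respect to \<open>\<nu>\<^sub>n\<close>. Hence, for a real constant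
  \<open>C \<ge> 0\<close>, the bound \<open>\<parallel>(C\<^bsub>w,f\<^esub>)\<^sup>n\<parallel> \<le> C\<close> is equivalent to \<open>\<nu>\<^sub>n(B) \<le> C\<^sup>p \<mu>(B)\<close> for all \<open>B\<close>
  of finite positive measure: one direction tests the operator on normalised indicators, the other
  compares the two measures on the \<open>\<sigma>\<close>-finite set where \<open>\<phi>\<close> does not vanish. Both claims follow.
\<close>

section \<open>Comparing two integrals through sets of finite measure\<close>

text \<open>Neither measure is assumed sigma-finite, so the bound on sets of finite measure need not
  extend to all measurable sets. A finite integral makes the set where \<open>g\<close> is nonzero
  sigma-finite, and only that set contributes to the integrals.\<close>

lemma nn_integral_le_of_emeasure_le_finite:
  fixes M N :: "'a measure" and K :: ennreal
  assumes sets_N: "sets N = sets M"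
    and g[measurable]: "g \<in> borel_measurable M"
    and fin: "(\<integral>\<^sup>+x. g x \<partial>M) < \<infinity>"
    and le: "\<And>B. B \<in> sets M \<Longrightarrow> emeasure M B < \<infinity> \<Longrightarrow> emeasure N B \<le> K * emeasure M B"
  shows "(\<integral>\<^sup>+x. g x \<partial>N) \<le> K * (\<integral>\<^sup>+x. g x \<partial>M)"
proof -
  have [measurable_cong]: "sets N = sets M" by (fact sets_N)
  have space_N: "space N = space M" using sets_N by (rule sets_eq_imp_space_eq)
  define S where "S = {x \<in> space M. g x \<noteq> 0}"
  have S[measurable]: "S \<in> sets M" unfolding S_def by measurable
  \<comment> \<open>\<open>R i\<close> is the set where \<open>g\<close> is at least 1/(i+1),
    written with a product to match Markov's inequality.\<close>
  define R where "R i = {x \<in> space M. 1 \<le> of_nat (Suc i) * g x}" for i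
  have R[measurable]: "R i \<in> sets M" for i unfolding R_def by measurable
  have R_fin: "emeasure M (R i) < \<infinity>" for i
  proof -
    have "emeasure M (R i) \<le> of_nat (Suc i) * (\<integral>\<^sup>+x. g x * indicator (space M) x \<partial>M)"
      unfolding R_def by (rule nn_integral_Markov_inequality) auto
    also have "\<dots> = of_nat (Suc i) * (\<integral>\<^sup>+x. g x \<partial>M)"
      by (intro arg_cong2[where f="(*)"] refl nn_integral_cong) auto
    also have "\<dots> < \<infinity>"
      using fin by (simp add: ennreal_mult_less_top of_nat_less_top del: of_nat_Suc)
    finally show ?thesis .
  qed
  have R_inc: "incseq R"
  proof (rule incseq_SucI)
    fix i
    have "of_nat (Suc i) * g x \<le> of_nat (Suc (Suc i)) * g x" for x
      by (intro mult_right_mono of_nat_mono) auto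
    then show "R i \<subseteq> R (Suc i)"
      unfolding R_def by (auto intro: order_trans simp del: of_nat_Suc)
  qed
  have S_eq: "S = (\<Union>i. R i)"
  proof (intro equalityI subsetI)
    fix x assume x: "x \<in> S"
    then have "g x \<noteq> 0" by (simp add: S_def)
    have "\<exists>i. 1 \<le> of_nat (Suc i) * g x"
    proof (cases "g x")
      case (real r)
      with \<open>g x \<noteq> 0\<close> have "0 < r" by (cases "r = 0") auto
      then obtain i where "1 / r < real i" using reals_Archimedean2 by blast
      with \<open>0 < r\<close> have "1 \<le> real (Suc i) * r" by (simp add: field_simps)
      then have "1 \<le> ennreal (real (Suc i) * r)" by (simp del: of_nat_Suc)
      also have "\<dots> = of_nat (Suc i) * g x"
        using real \<open>0 < r\<close> by (simp add: ennreal_mult ennreal_of_nat_eq_real_of_nat del: of_nat_Suc)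
      finally show ?thesis by blast
    next
      case top
      then show ?thesis by (intro exI[of _ 0]) simp
    qed
    then show "x \<in> (\<Union>i. R i)" using x by (auto simp: R_def S_def)
  next
    fix x assume "x \<in> (\<Union>i. R i)"
    then show "x \<in> S" by (auto simp: R_def S_def)
  qed
  \<comment> \<open>Each \<open>A \<inter> R i\<close> has finite measure, so \<open>le\<close>
    applies to it; continuity from below passes to \<open>A \<inter> S\<close>.\<close>
  have le_S: "emeasure N (A \<inter> S) \<le> K * emeasure M (A \<inter> S)" if A[measurable]: "A \<in> sets M" for A
  proof -
    have "emeasure N (A \<inter> S) = (SUP i. emeasure N (A \<inter> R i))"
      using R_inc by (subst SUP_emeasure_incseq) (auto simp: incseq_def S_eq)
    also have "\<dots> \<le> K * emeasure M (A \<inter> S)"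
    proof (rule SUP_least)
      fix i
      have "emeasure M (A \<inter> R i) \<le> emeasure M (R i)" by (rule emeasure_mono) auto
      then have "emeasure N (A \<inter> R i) \<le> K * emeasure M (A \<inter> R i)"
        using R_fin[of i] by (intro le) auto
      also have "\<dots> \<le> K * emeasure M (A \<inter> S)"
        by (intro mult_left_mono emeasure_mono) (auto simp: S_eq)
      finally show "emeasure N (A \<inter> R i) \<le> K * emeasure M (A \<inter> S)" .
    qed
    finally show ?thesis .
  qed
  \<comment> \<open>Restricting both measures to \<open>S\<close> gives an inequality on all
    measurable sets, hence one between measures; the integrals of \<open>g\<close> lose nothing,
    since \<open>g\<close> vanishes off \<open>S\<close>.\<close>
  let ?N = "density N (indicator S)" and ?M = "density M (\<lambda>x. K * indicator S x)"
  have ind: "(\<lambda>x. indicator S x * indicator A x :: ennreal) = indicator (A \<inter> S)" for A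
    by (auto simp: indicator_def)
  have "?N \<le> ?M"
    using sets_N le_S
    by (subst le_measure)
      (auto simp: le_fun_def emeasure_density ind mult.assoc nn_integral_cmult)
  then have "(\<integral>\<^sup>+x. g x \<partial>?N) \<le> (\<integral>\<^sup>+x. g x \<partial>?M)"
    using sets_N by (intro nn_integral_mono_measure) auto
  moreover have "(\<integral>\<^sup>+x. g x \<partial>?N) = (\<integral>\<^sup>+x. g x \<partial>N)"
    by (subst nn_integral_density) (auto intro!: nn_integral_cong simp: S_def space_N indicator_def)
  moreover have "(\<integral>\<^sup>+x. g x \<partial>?M) = (\<integral>\<^sup>+x. K * g x \<partial>M)"
    by (subst nn_integral_density) (auto intro!: nn_integral_cong simp: S_def indicator_def)
  ultimately show ?thesis by (simp add: nn_integral_cmult)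
qed

section \<open>Roots, norms and real upper bounds\<close>

lemma powr_inverse_le_iff:
  fixes p t C :: real
  assumes p: "0 < p" and t: "0 \<le> t" and C: "0 \<le> C"
  shows "t powr (1 / p) \<le> C \<longleftrightarrow> t \<le> C powr p"
proof -
  have "t powr (1 / p) \<le> C \<longleftrightarrow> (t powr (1 / p)) powr p \<le> C powr p"
    using p C by (meson linorder_not_less powr_ge_zero powr_less_mono2 powr_mono2 less_imp_le)
  then show ?thesis using p t by (simp add: powr_powr)
qed

text \<open>Integrability makes the Bochner integral in the norm agree with the nonnegative
  integral, the form in which measures can be compared.\<close>

lemma Lp_fun_norm_le_iff:
  fixes \<phi> :: "'a \<Rightarrow> 'k::{real_normed_field, banach, second_countable_topology}"
  assumes p: "0 < p" and \<phi>: "\<phi> \<in> Lp_fun M p" and C: "0 \<le> C"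
  shows "Lp_fun_norm M p \<phi> \<le> C \<longleftrightarrow> (\<integral>\<^sup>+x. ennreal (norm (\<phi> x) powr p) \<partial>M) \<le> ennreal (C powr p)"
proof -
  let ?I = "\<integral>x. norm (\<phi> x) powr p \<partial>M"
  have "(\<integral>\<^sup>+x. ennreal (norm (\<phi> x) powr p) \<partial>M) = ennreal ?I"
    using \<phi> by (intro nn_integral_eq_integral) (auto simp: Lp_fun_def)
  moreover have "?I powr (1 / p) \<le> C \<longleftrightarrow> ?I \<le> C powr p"
    by (rule powr_inverse_le_iff[OF p _ C]) simp
  ultimately show ?thesis by (simp add: Lp_fun_norm_def)
qed

text \<open>Division by a finite positive \<open>b\<close> can be undone by multiplication. For
  infinite \<open>a\<close> both sides are false.\<close>

lemma ennreal_powr_divide_le_iff: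
  assumes p: "0 < p" and b: "0 < b" "b < \<infinity>" and C: "0 \<le> C"
  shows "ennreal_powr (a / b) (1 / p) \<le> ennreal C \<longleftrightarrow> a \<le> ennreal (C powr p) * b"
proof (cases "a = \<infinity>")
  case True
  then show ?thesis
    using b by (auto simp: ennreal_powr_def ennreal_top_divide top_unique ennreal_mult_eq_top_iff)
next
  case False
  obtain s where s: "b = ennreal s" "0 < s" using b by (cases b) auto
  obtain r where r: "a = ennreal r" "0 \<le> r" using False by (cases a) auto
  have "(r / s) powr (1 / p) \<le> C \<longleftrightarrow> r / s \<le> C powr p"
    using r s by (intro powr_inverse_le_iff[OF p _ C]) simp
  also have "\<dots> \<longleftrightarrow> r \<le> C powr p * s" using s by (simp add: field_simps)
  finally show ?thesis
    using r s C by (simp add: ennreal_powr_def divide_ennreal ennreal_mult'[symmetric])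
qed

text \<open>If one of the numbers is finite, it serves as \<open>C\<close> itself; an infinite one
  bounds the other trivially.\<close>

lemma ennreal_eqI_le_real:
  fixes a b :: ennreal
  assumes "\<And>C::real. 0 \<le> C \<Longrightarrow> a \<le> ennreal C \<longleftrightarrow> b \<le> ennreal C"
  shows "a = b"
proof (rule antisym)
  show "a \<le> b" using assms by (cases b) auto
  show "b \<le> a" using assms by (cases a) auto
qed

section \<open>Iterates on representatives and the measures they induce\<close>

context weighted_composition
begin

definition iter_fun :: "nat \<Rightarrow> ('a \<Rightarrow> 'k) \<Rightarrow> 'a \<Rightarrow> 'k"
  where "iter_fun n \<phi> x = \<phi> ((f ^^ n) x) * iter_weight w f n x"

text \<open>This is \<open>\<nu>\<^sub>n\<close>, built as a push-forward so that integrals against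
  it follow from change of variables.\<close>

definition pulled_measure :: "nat \<Rightarrow> 'a measure"
  where "pulled_measure n = distr (iter_measure M p w f n) M (f ^^ n)"

lemma f_measurable[measurable]: "f \<in> M \<rightarrow>\<^sub>M M"
  using f_bimeasurable by (simp add: bimeasurable_def)

lemma funpow_measurable[measurable]: "f ^^ n \<in> M \<rightarrow>\<^sub>M M"
  by (induction n) (auto intro: measurable_comp)

lemma iter_weight_measurable[measurable]: "iter_weight w f n \<in> borel_measurable M"
proof -
  note w_measurable[measurable]
  have "(\<lambda>x. \<Prod>i<n. w ((f ^^ i) x)) \<in> borel_measurable M" by measurable
  then show ?thesis by (simp add: iter_weight_def[abs_def])
qed

lemma sets_pulled_measure[simp, measurable_cong]: "sets (pulled_measure n) = sets M"
  by (simp add: pulled_measure_def)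

lemma emeasure_pulled_measure:
  assumes "B \<in> sets M"
  shows "emeasure (pulled_measure n) B = emeasure (iter_measure M p w f n) ((f ^^ n) -` B \<inter> space M)"
proof -
  have "f ^^ n \<in> iter_measure M p w f n \<rightarrow>\<^sub>M M" by (simp add: iter_measure_def)
  then show ?thesis
    using assms by (simp add: pulled_measure_def emeasure_distr iter_measure_def)
qed

text \<open>Splitting off the factor with index 0, not the last one, exposes one outer application
  of the operator, as the inductions below need.\<close>

lemma iter_fun_Suc: "iter_fun (Suc n) \<phi> = (\<lambda>x. iter_fun n \<phi> (f x) * w x)"
  by (simp add: iter_fun_def fun_eq_iff iter_weight_def prod.lessThan_Suc_shift funpow_swap1
      mult_ac del: prod.lessThan_Suc)

lemma iter_fun_cong:
  assumes "(\<phi>, \<psi>) \<in> Lp_rel M p"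
  shows "(iter_fun n \<phi>, iter_fun n \<psi>) \<in> Lp_rel M p"
proof (induction n)
  case 0
  then show ?case using assms by (simp add: iter_fun_def[abs_def] iter_weight_def)
next
  case (Suc n)
  then show ?case unfolding iter_fun_Suc by (rule wc_fun_cong)
qed

lemma iter_fun_in_Lp_fun:
  assumes "\<phi> \<in> Lp_fun M p"
  shows "iter_fun n \<phi> \<in> Lp_fun M p"
proof -
  have "(\<phi>, \<phi>) \<in> Lp_rel M p" using assms by (simp add: Lp_rel_def)
  from iter_fun_cong[OF this, of n] show ?thesis by (simp add: Lp_rel_def)
qed

lemma wc_op_funpow_class:
  assumes "\<phi> \<in> Lp_fun M p"
  shows "(wc_op M p w f ^^ n) (Lp_rel M p `` {\<phi>}) = Lp_rel M p `` {iter_fun n \<phi>}"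
proof (induction n)
  case 0
  then show ?case by (simp add: iter_fun_def[abs_def] iter_weight_def)
next
  case (Suc n)
  then show ?case by (simp add: wc_op_class iter_fun_in_Lp_fun assms iter_fun_Suc)
qed

lemma nn_integral_iter_fun:
  assumes [measurable]: "\<phi> \<in> borel_measurable M"
  shows "(\<integral>\<^sup>+x. ennreal (norm (iter_fun n \<phi> x) powr p) \<partial>M)
    = (\<integral>\<^sup>+x. ennreal (norm (\<phi> x) powr p) \<partial>pulled_measure n)"
  by (simp add: pulled_measure_def iter_measure_def nn_integral_distr nn_integral_density
      iter_fun_def norm_mult powr_mult ennreal_mult' mult.commute)

text \<open>Supplies the null sets, about which the bound on sets of positive measure says nothing.
  The indicator of \<open>B\<close> and 0 lie in the same class, so their iterates agree almost
  everywhere.\<close>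

lemma pulled_measure_null:
  assumes B[measurable]: "B \<in> sets M" and null: "emeasure M B = 0"
  shows "emeasure (pulled_measure n) B = 0"
proof -
  have AE: "AE x in M. indicator B x = (0::'k)"
    using null B by (auto intro!: AE_I[of _ _ B] simp: indicator_def)
  have "integrable M (\<lambda>x. norm (indicator B x :: 'k) powr p) \<longleftrightarrow> integrable M (\<lambda>x. 0::real)"
    using AE by (intro integrable_cong_AE) auto
  then have "((indicator B :: 'a \<Rightarrow> 'k), \<lambda>x. 0) \<in> Lp_rel M p"
    using AE by (auto simp: Lp_rel_def Lp_fun_def)
  from iter_fun_cong[OF this, of n]
  have "AE x in M. iter_fun n (indicator B) x = iter_fun n (\<lambda>x. 0) x" by (simp add: Lp_rel_def)
  then have "(\<integral>\<^sup>+x. ennreal (norm (iter_fun n (indicator B) x) powr p) \<partial>M) = (\<integral>\<^sup>+x. 0 \<partial>M)"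
    by (intro nn_integral_cong_AE) (auto simp: iter_fun_def)
  then have "(\<integral>\<^sup>+x. ennreal (norm (indicator B x :: 'k) powr p) \<partial>pulled_measure n) = 0"
    by (simp add: nn_integral_iter_fun)
  moreover have "(\<lambda>x. ennreal (norm (indicator B x :: 'k) powr p)) = indicator B"
    by (auto simp: indicator_def)
  ultimately show ?thesis by simp
qed

section \<open>Operator norm bounds as inequalities between measures\<close>

text \<open>Serves both claims: varying \<open>C\<close> for one \<open>n\<close> determines the
  norm, and one \<open>C\<close> for all \<open>n\<close> expresses power-boundedness. The value
  \<open>C = 0\<close> is allowed so that vanishing norms are covered.\<close>

lemma Lp_opnorm_funpow_le_iff:
  assumes p: "0 < p" and C: "0 \<le> C"
  shows "Lp_opnorm M p (wc_op M p w f ^^ n) \<le> ennreal C \<longleftrightarrow>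
    (\<forall>B\<in>sets M. 0 < emeasure M B \<and> emeasure M B < \<infinity> \<longrightarrow>
      emeasure (pulled_measure n) B \<le> ennreal (C powr p) * emeasure M B)"
    (is "?L \<longleftrightarrow> ?R")
proof -
  \<comment> \<open>Passes from classes to representatives, then takes p-th powers and changes
    variables.\<close>
  have L_iff: "?L \<longleftrightarrow> (\<forall>\<phi>\<in>(Lp_fun M p :: ('a \<Rightarrow> 'k) set). (\<integral>\<^sup>+x. ennreal (norm (\<phi> x) powr p) \<partial>M) \<le> 1 \<longrightarrow>
    (\<integral>\<^sup>+x. ennreal (norm (\<phi> x) powr p) \<partial>pulled_measure n) \<le> ennreal (C powr p))"
    (is "_ \<longleftrightarrow> ?T")
  proof -
    have "?L \<longleftrightarrow> (\<forall>F\<in>Lp M p. Lp_norm M p F \<le> 1 \<longrightarrow> Lp_norm M p ((wc_op M p w f ^^ n) F) \<le> C)"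
      using C by (auto simp: Lp_opnorm_def SUP_le_iff)
    also have "\<dots> \<longleftrightarrow>
      (\<forall>\<phi>\<in>(Lp_fun M p :: ('a \<Rightarrow> 'k) set). Lp_fun_norm M p \<phi> \<le> 1 \<longrightarrow> Lp_fun_norm M p (iter_fun n \<phi>) \<le> C)"
      by (auto simp: Lp_def quotient_def wc_op_funpow_class Lp_norm_class iter_fun_in_Lp_fun)
    also have "\<dots> \<longleftrightarrow> ?T"
    proof (intro ball_cong refl)
      fix \<phi> :: "'a \<Rightarrow> 'k" assume \<phi>: "\<phi> \<in> Lp_fun M p"
      then have "\<phi> \<in> borel_measurable M" by (simp add: Lp_fun_def)
      then show "(Lp_fun_norm M p \<phi> \<le> 1 \<longrightarrow> Lp_fun_norm M p (iter_fun n \<phi>) \<le> C) \<longleftrightarrow>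
        ((\<integral>\<^sup>+x. ennreal (norm (\<phi> x) powr p) \<partial>M) \<le> 1 \<longrightarrow>
          (\<integral>\<^sup>+x. ennreal (norm (\<phi> x) powr p) \<partial>pulled_measure n) \<le> ennreal (C powr p))"
        using p C \<phi> by (simp add: Lp_fun_norm_le_iff iter_fun_in_Lp_fun nn_integral_iter_fun)
    qed
    finally show ?thesis .
  qed
  show ?thesis
  proof
    assume L: ?L
    show ?R
    proof (intro ballI impI, elim conjE)
      fix B assume B[measurable]: "B \<in> sets M" and pos: "0 < emeasure M B" "emeasure M B < \<infinity>"
      obtain m where m: "emeasure M B = ennreal m" "0 < m" using pos by (cases "emeasure M B") auto
      \<comment> \<open>The indicator of \<open>B\<close> scaled to norm 1: its p-th power
        integrates to 1 since \<open>m\<close> is the measure of \<open>B\<close>.\<close>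
      define \<phi> :: "'a \<Rightarrow> 'k" where "\<phi> x = of_real (m powr (- 1 / p)) * indicator B x" for x
      have \<phi>_meas[measurable]: "\<phi> \<in> borel_measurable M" unfolding \<phi>_def[abs_def] by measurable
      have \<phi>_powr: "norm (\<phi> x) powr p = (1 / m) * indicator B x" for x
        using p m by (auto simp: \<phi>_def norm_mult norm_divide powr_divide powr_powr powr_minus_divide split: split_indicator)
      \<comment> \<open>Stated for any \<open>Q\<close> because it is used for both \<open>M\<close>
        and \<open>pulled_measure n\<close>.\<close>
      have int: "(\<integral>\<^sup>+x. ennreal (norm (\<phi> x) powr p) \<partial>Q) = ennreal (1 / m) * emeasure Q B"
        if "sets Q = sets M" for Q
      proof -
        have "ennreal (norm (\<phi> x) powr p) = ennreal (1 / m) * indicator B x" for x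
          unfolding \<phi>_powr by (simp split: split_indicator)
        then show ?thesis using that by (simp add: nn_integral_cmult_indicator)
      qed
      have one: "(\<integral>\<^sup>+x. ennreal (norm (\<phi> x) powr p) \<partial>M) = 1"
        using m by (simp add: int ennreal_mult'[symmetric])
      then have "\<phi> \<in> Lp_fun M p" by (simp add: Lp_fun_def integrable_iff_bounded)
      with L one have "ennreal (1 / m) * emeasure (pulled_measure n) B \<le> ennreal (C powr p)"
        by (simp add: L_iff int[symmetric])
      then have "ennreal m * (ennreal (1 / m) * emeasure (pulled_measure n) B)
          \<le> ennreal m * ennreal (C powr p)"
        by (rule mult_left_mono) simp
      moreover have "ennreal m * ennreal (1 / m) = 1" using m by (simp add: ennreal_mult'[symmetric])
      ultimately show "emeasure (pulled_measure n) B \<le> ennreal (C powr p) * emeasure M B"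
        by (simp add: m mult.assoc[symmetric] mult.commute)
    qed
  next
    assume R: ?R
    show ?L unfolding L_iff
    proof (intro ballI impI)
      fix \<phi> :: "'a \<Rightarrow> 'k"
      assume \<phi>: "\<phi> \<in> Lp_fun M p" and le1: "(\<integral>\<^sup>+x. ennreal (norm (\<phi> x) powr p) \<partial>M) \<le> 1"
      then have [measurable]: "\<phi> \<in> borel_measurable M" by (simp add: Lp_fun_def)
      have "(\<integral>\<^sup>+x. ennreal (norm (\<phi> x) powr p) \<partial>pulled_measure n)
          \<le> ennreal (C powr p) * (\<integral>\<^sup>+x. ennreal (norm (\<phi> x) powr p) \<partial>M)"
      proof (rule nn_integral_le_of_emeasure_le_finite)
        show "(\<integral>\<^sup>+x. ennreal (norm (\<phi> x) powr p) \<partial>M) < \<infinity>"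
          using le1 by (auto intro: le_less_trans)
        show "emeasure (pulled_measure n) B \<le> ennreal (C powr p) * emeasure M B"
          if "B \<in> sets M" "emeasure M B < \<infinity>" for B
          \<comment> \<open>\<open>R\<close> covers positive measure; null sets need absolute
            continuity.\<close>
          using that R pulled_measure_null[of B n] by (cases "emeasure M B = 0") (auto simp: zero_less_iff_neq_zero)
      qed auto
      also have "\<dots> \<le> ennreal (C powr p) * 1" by (intro mult_left_mono le1) simp
      finally show "(\<integral>\<^sup>+x. ennreal (norm (\<phi> x) powr p) \<partial>pulled_measure n) \<le> ennreal (C powr p)"
        by simp
    qed
  qed
qed

end

section \<open>The norm formula and the criterion for power-boundedness\<close>

theorem theorem6:
  fixes M :: "'a measure" and p :: real
    and w :: "'a \<Rightarrow> 'k::{real_normed_field, banach, second_countable_topology}"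
    and f :: "'a \<Rightarrow> 'a"
  assumes "1 \<le> p"
    and "weighted_composition M p w f"
  shows "(\<forall>n\<ge>1. Lp_opnorm M p (wc_op M p w f ^^ n) =
        (SUP B \<in> {B \<in> sets M. 0 < emeasure M B \<and> emeasure M B < \<infinity>}.
          ennreal_powr
            (emeasure (iter_measure M p w f n) ((f ^^ n) -` B \<inter> space M) / emeasure M B) (1 / p)))
    \<and> (power_bounded M p (wc_op M p w f) \<longleftrightarrow>
        (\<exists>C::real. 0 < C \<and>
          (\<forall>B\<in>sets M. 0 < emeasure M B \<and> emeasure M B < \<infinity> \<longrightarrow>
            (\<forall>n\<ge>1. emeasure (iter_measure M p w f n) ((f ^^ n) -` B \<inter> space M)
              \<le> ennreal C * emeasure M B))))"
proof -
  interpret weighted_composition M p w f by fact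
  have p: "0 < p" using assms(1) by simp
  let ?\<nu> = "\<lambda>n B. emeasure (iter_measure M p w f n) ((f ^^ n) -` B \<inter> space M)"
  have bound: "Lp_opnorm M p (wc_op M p w f ^^ n) \<le> ennreal C \<longleftrightarrow>
      (\<forall>B\<in>sets M. 0 < emeasure M B \<and> emeasure M B < \<infinity> \<longrightarrow>
        ?\<nu> n B \<le> ennreal (C powr p) * emeasure M B)" if "0 \<le> C" for C n
    using Lp_opnorm_funpow_le_iff[OF p that, of n] by (simp add: emeasure_pulled_measure)
  \<comment> \<open>Both sides have the same real upper bounds. If no set has finite positive
    measure, the supremum over the empty set is 0 in \<open>ennreal\<close>, as the convention
    requires.\<close>
  have "Lp_opnorm M p (wc_op M p w f ^^ n) =
      (SUP B \<in> {B \<in> sets M. 0 < emeasure M B \<and> emeasure M B < \<infinity>}.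
        ennreal_powr (?\<nu> n B / emeasure M B) (1 / p))" for n
    by (rule ennreal_eqI_le_real)
      (auto simp: bound SUP_le_iff ennreal_powr_divide_le_iff[OF p])
  moreover have "power_bounded M p (wc_op M p w f) \<longleftrightarrow>
      (\<exists>C::real. 0 < C \<and> (\<forall>B\<in>sets M. 0 < emeasure M B \<and> emeasure M B < \<infinity> \<longrightarrow>
        (\<forall>n\<ge>1. ?\<nu> n B \<le> ennreal C * emeasure M B)))"
    (is "_ \<longleftrightarrow> (\<exists>C. 0 < C \<and> ?P C)")
  proof -
    \<comment> \<open>A norm bound \<open>C\<close> corresponds to the measure bound
      \<open>C powr p\<close>, independent of \<open>n\<close>, so the quantifiers over
      \<open>n\<close> and \<open>B\<close> can be exchanged.\<close>
    have iff: "(\<forall>n\<ge>1. Lp_opnorm M p (wc_op M p w f ^^ n) \<le> ennreal C) \<longleftrightarrow> ?P (C powr p)"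
      if "0 < C" for C
      using that by (auto simp: bound)
    show ?thesis
    proof
      assume "power_bounded M p (wc_op M p w f)"
      then obtain C where C: "0 < C" "\<forall>n\<ge>1. Lp_opnorm M p (wc_op M p w f ^^ n) \<le> ennreal C"
        unfolding power_bounded_def by blast
      then show "\<exists>C. 0 < C \<and> ?P C"
        by (intro exI[of _ "C powr p"] conjI) (simp, subst (asm) iff, auto)
    next
      assume "\<exists>C. 0 < C \<and> ?P C"
      then obtain C where C: "0 < C" "?P C" by blast
      \<comment> \<open>The converse takes the p-th root of the measure constant as the norm
        bound.\<close>
      have "(C powr (1 / p)) powr p = C" using C(1) p by (simp add: powr_powr)
      with C have "?P ((C powr (1 / p)) powr p)" by simp
      then show "power_bounded M p (wc_op M p w f)"
        unfolding power_bounded_def using C(1) iff[of "C powr (1 / p)"]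
        by (intro exI[of _ "C powr (1 / p)"]) simp
    qed
  qed
  ultimately show ?thesis by blast
qed

end
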